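(* Let $\alpha>0$, $\beta>0$, $p\in[0,1]$, let $X\sim\mathrm{RTUOMG}(\alpha,\beta,p)$, and let $r$ be a positive integer. Then the $r$th moment $\mu'_r=\mathbb{E}[X^r]=\int_0^1 x^r f_X(x;\alpha,\beta,p)\,dx$ is $$\begin{aligned} \mu'_{r}=\;& 2\alpha(1-p)\, B\Big(\frac{r}{\beta}+1, \alpha\Big)\;{}_{2}F_{1} \Big(\alpha+1,\frac{r}{\beta}+1; \frac{r}{\beta}+\alpha+1;-1\Big) \\ & + 4p\alpha^2 \sum_{k=1}^{\infty}\left[\frac{1}{2k-1}\, B\Big(\frac{r}{\beta}+2k, \alpha\Big)\;{}_{2}F_{1} \Big(\alpha+1,\frac{r}{\beta}+2k; \frac{r}{\beta}+2k+\alpha;-1\Big)\right]. \end{aligned}$$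
   Context: For $\alpha,\beta>0$ and $0<x<1$ write $$\omega_{1}^{(-2\alpha,\beta)}(x)=\left(\frac{1+x^\beta}{1-x^\beta}\right)^{-\alpha}.$$ A random variable $X$ has the record-based transmuted unit omega distribution $\mathrm{RTUOMG}(\alpha,\beta,p)$, with $\alpha>0$, $\beta>0$, $p\in[0,1]$, if it is supported on $(0,1)$ with density $$f_{X}(x;\alpha,\beta,p)=\left(\frac{2\alpha\beta x^{\beta-1}}{1-x^{2\beta}}\right)\omega_{1}^{(-2\alpha,\beta)}(x)\left[ 1-p-p \log \left(\omega_{1}^{(-2\alpha,\beta)}(x)\right) \right],\qquad 0<x<1.$$ $B(a,b)=\int_0^1 t^{a-1}(1-t)^{b-1}\,dt$ ($a,b>0$) is the beta function. ${}_2F_1(a,b;c;x)$ is the Gauss hypergeometric function, given for $|x|<1$ by $\sum_{i=0}^\infty \frac{(a)_i(b)_i}{(c)_i}\frac{x^i}{i!}$ with $(n)_i=n(n+1)\cdots(n+i-1)$, $(n)_0=1$, and extended by analytic continuation to $x\in\mathbb{C}\setminus[1,\infty)$; in particular, for real $c>b>0$ and real $x<1$, $B(b,c-b)\,{}_2F_1(a,b;c;x)=\int_0^1 t^{b-1}(1-t)^{c-b-1}(1-xt)^{-a}\,dt$. *)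

theory Defs
  imports "HOL-Probability.Probability" "HOL-Complex_Analysis.Complex_Analysis"
begin

definition omega :: "real \<Rightarrow> real \<Rightarrow> real \<Rightarrow> real" where
  "omega \<alpha> \<beta> x = ((1 + x powr \<beta>) / (1 - x powr \<beta>)) powr (- \<alpha>)"

definition rtuomg_density :: "real \<Rightarrow> real \<Rightarrow> real \<Rightarrow> real \<Rightarrow> real" where
  "rtuomg_density \<alpha> \<beta> p x =
     (if 0 < x \<and> x < 1
      then (2 * \<alpha> * \<beta> * x powr (\<beta> - 1) / (1 - x powr (2 * \<beta>))) * omega \<alpha> \<beta> x
             * (1 - p - p * ln (omega \<alpha> \<beta> x))
      else 0)"

definition RTUOMG :: "'a measure \<Rightarrow> ('a \<Rightarrow> real) \<Rightarrow> real \<Rightarrow> real \<Rightarrow> real \<Rightarrow> bool" where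
  "RTUOMG M X \<alpha> \<beta> p \<longleftrightarrow> distributed M lborel X (\<lambda>x. ennreal (rtuomg_density \<alpha> \<beta> p x))"

definition hyp2F1_series :: "complex \<Rightarrow> complex \<Rightarrow> complex \<Rightarrow> complex \<Rightarrow> complex" where
  "hyp2F1_series a b c z =
     (\<Sum>i. pochhammer a i * pochhammer b i / pochhammer c i * (z ^ i / fact i))"

definition slit_plane :: "complex set" where
  "slit_plane = - (complex_of_real ` {1..})"

text \<open>The Gauss hypergeometric function on the slit plane: the value at \<open>z\<close> of the
  holomorphic continuation of the series from the unit disc. The continuation is unique
  (lemma \<open>hyp2F1_eqI\<close> below); on the cut the value is left unspecified.\<close>

definition hyp2F1 :: "complex \<Rightarrow> complex \<Rightarrow> complex \<Rightarrow> complex \<Rightarrow> complex" where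
  "hyp2F1 a b c z =
     (THE w. \<exists>F. F holomorphic_on slit_plane \<and>
                 (\<forall>u. norm u < 1 \<longrightarrow> F u = hyp2F1_series a b c u) \<and> w = F z)"

lemma open_slit_plane: "open slit_plane"
proof -
  have "closed (complex_of_real ` {1..})"
    by (intro closed_injective_linear_image) (auto intro!: linearI simp: inj_on_def scaleR_conv_of_real)
  then show ?thesis by (simp add: slit_plane_def open_Compl)
qed

lemma slit_plane_iff: "z \<in> slit_plane \<longleftrightarrow> \<not> (Im z = 0 \<and> Re z \<ge> 1)"
proof -
  have "z \<in> complex_of_real ` {1..} \<longleftrightarrow> Im z = 0 \<and> Re z \<ge> 1"
    by (auto simp: image_iff complex_eq_iff)
  then show ?thesis by (simp add: slit_plane_def)
qed

lemma connected_slit_plane: "connected slit_plane"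
proof -
  have "u *\<^sub>R z \<in> slit_plane" if "z \<in> slit_plane" "0 \<le> u" "u \<le> 1" for u z
    using that mult_mono[of u 1 "Re z" "Re z"] zero_le_mult_iff[of u "Re z"]
    by (auto simp: slit_plane_iff)
  then have "closed_segment 0 z \<subseteq> slit_plane" if "z \<in> slit_plane" for z
    using that by (auto simp: closed_segment_def)
  moreover have "0 \<in> slit_plane" by (simp add: slit_plane_iff)
  ultimately have "starlike slit_plane" unfolding starlike_def by blast
  then show ?thesis by (rule starlike_imp_connected)
qed

lemma hyp2F1_eqI:
  assumes F: "F holomorphic_on slit_plane" "\<And>u. norm u < 1 \<Longrightarrow> F u = hyp2F1_series a b c u"
    and z: "z \<in> slit_plane"
  shows "hyp2F1 a b c z = F z"
  unfolding hyp2F1_def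
proof (rule the_equality)
  show "\<exists>G. G holomorphic_on slit_plane \<and>
          (\<forall>u. norm u < 1 \<longrightarrow> G u = hyp2F1_series a b c u) \<and> F z = G z"
    using F by blast
next
  fix w
  assume "\<exists>G. G holomorphic_on slit_plane \<and>
            (\<forall>u. norm u < 1 \<longrightarrow> G u = hyp2F1_series a b c u) \<and> w = G z"
  then obtain G where G: "G holomorphic_on slit_plane"
    "\<And>u. norm u < 1 \<Longrightarrow> G u = hyp2F1_series a b c u" "w = G z" by blast
  have sub: "ball 0 1 \<subseteq> slit_plane"
  proof
    fix u :: complex assume "u \<in> ball 0 1"
    then show "u \<in> slit_plane"
      using abs_Re_le_cmod[of u] by (auto simp: slit_plane_iff)
  qed
  have "G z = F z"
    by (rule analytic_continuation_open[OF open_ball open_slit_plane _ connected_slit_plane sub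
          G(1) F(1) _ z])
       (auto simp: F(2) G(2))
  then show "w = F z" using G(3) by simp
qed

end

theory Submission
  imports Defs
begin

text \<open>
  Substituting \<open>t = x powr \<beta>\<close> turns the moment into an integral over \<open>(0, 1)\<close> against the weight
  \<open>t powr (r / \<beta>) * (1 - t) powr (\<alpha> - 1) * (1 + t) powr (- (\<alpha> + 1))\<close>: the factor \<open>omega\<close> becomes
  \<open>((1 - t) / (1 + t)) powr \<alpha>\<close>, and the denominator \<open>1 - x powr (2 * \<beta>) = (1 - t) * (1 + t)\<close> lowers
  both exponents by one (\<open>rtuomg_moment_integral\<close>). What multiplies the weight is a constant plus a multiple of
  \<open>ln ((1 + t) / (1 - t)) = 2 * (t + t^3 / 3 + t^5 / 5 + \<dots>)\<close>. All terms of this series are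
  nonnegative, so it may be integrated term by term once its sum is integrable against the weight; each
  odd power of \<open>t\<close> only shifts the exponent of \<open>t\<close> in the weight (\<open>log_kernel_sums\<close>).

  Every integral that remains is Euler's integral
  \<open>\<integral> t powr (b - 1) * (1 - t) powr (d - 1) * (1 - z * t) powr (- a)\<close> at \<open>z = -1\<close>, which equals
  \<open>Beta b d\<close> times the hypergeometric function with parameters \<open>a\<close>, \<open>b\<close>, \<open>b + d\<close>
  (\<open>hyp2F1_minus_one\<close>). The point \<open>-1\<close> is on the boundary of the disc of convergence, so the value there is
  that of the analytic continuation. It is identified by two facts about Euler's
  integral as a function of \<open>z\<close>: on the unit disc, integrating the binomial series term by term gives the
  hypergeometric series (\<open>Euler_integral_series\<close>), and on the whole slit plane the integral is holomorphic, by
  differentiation under the integral sign (\<open>holomorphic_Euler_integral\<close>).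
\<close>

section \<open>The beta measure\<close>

text \<open>With the singular beta weight absorbed into a finite measure, Euler's integral has a bounded
  integrand, so constants serve as dominating functions.\<close>

definition beta_measure :: "real \<Rightarrow> real \<Rightarrow> real measure" where
  "beta_measure b d =
     density lborel (\<lambda>t. ennreal (indicator {0<..<1} t * (t powr (b - 1) * (1 - t) powr (d - 1))))"

lemma sets_beta_measure [simp, measurable_cong]: "sets (beta_measure b d) = sets borel"
  by (simp add: beta_measure_def)

lemma AE_beta_measure: "AE t in beta_measure b d. 0 < t \<and> t < 1"
  unfolding beta_measure_def by (subst AE_density) (auto simp: indicator_def)

lemma integral_beta_measure:
  fixes f :: "real \<Rightarrow> 'b::{banach, second_countable_topology}"
  assumes [measurable]: "f \<in> borel_measurable borel"
  shows "integral\<^sup>L (beta_measure b d) f =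
           (LINT t:{0<..<1}|lborel. (t powr (b - 1) * (1 - t) powr (d - 1)) *\<^sub>R f t)"
    and "integrable (beta_measure b d) f \<longleftrightarrow>
           set_integrable lborel {0<..<1} (\<lambda>t. (t powr (b - 1) * (1 - t) powr (d - 1)) *\<^sub>R f t)"
  unfolding beta_measure_def set_lebesgue_integral_def set_integrable_def
  by (subst integral_density integrable_density; simp add: mult_ac)+

lemma set_integral_Beta:
  fixes b d :: real
  assumes "b > 0" "d > 0"
  shows "set_integrable lborel {0<..<1} (\<lambda>t. t powr (b - 1) * (1 - t) powr (d - 1))"
    and "(LINT t:{0<..<1}|lborel. t powr (b - 1) * (1 - t) powr (d - 1)) = Beta b d"
proof -
  show int: "set_integrable lborel {0<..<1} (\<lambda>t. t powr (b - 1) * (1 - t) powr (d - 1))"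
    by (rule set_integrable_subset[OF integrable_Beta[OF assms]]) auto
  show "(LINT t:{0<..<1}|lborel. t powr (b - 1) * (1 - t) powr (d - 1)) = Beta b d"
    using set_borel_integral_eq_integral(2)[OF int] has_integral_Beta_real[OF assms]
    by (simp add: has_integral_Icc_iff_Ioo integral_unique)
qed

lemma Beta_real_pos:
  fixes b d :: real
  assumes "b > 0" "d > 0"
  shows "Beta b d > 0"
  using assms unfolding Beta_def by (intro divide_pos_pos mult_pos_pos Gamma_real_pos) auto

lemma finite_measure_beta_measure:
  assumes "b > 0" "d > 0"
  shows "finite_measure (beta_measure b d)"
proof -
  have "integrable (beta_measure b d) (\<lambda>_. 1 :: real)"
    using set_integral_Beta(1)[OF assms] by (simp add: integral_beta_measure)
  from integrableD(2)[OF this] show ?thesis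
    by (intro finite_measureI) simp
qed

lemma Beta_add_nat:
  fixes b d :: real
  assumes "b > 0" "d > 0"
  shows "Beta (b + real n) d = Beta b d * pochhammer b n / pochhammer (b + d) n"
proof (induction n)
  case (Suc n)
  have "(b + real n + d) * Beta (b + real n + 1) d = (b + real n) * Beta (b + real n) d"
    by (rule Beta_plus1_left) (use assms in \<open>auto elim!: nonpos_Ints_cases\<close>)
  moreover have "b + real n + d > 0"
    using assms by simp
  ultimately have "Beta (b + real (Suc n)) d = (b + real n) / (b + real n + d) * Beta (b + real n) d"
    by (simp add: eq_divide_eq add_ac mult_ac)
  then show ?case
    by (simp add: Suc pochhammer_rec' add_ac mult_ac)
qed simp

lemma integral_power_beta_measure:
  assumes "b > 0" "d > 0"
  shows "(LINT t|beta_measure b d. complex_of_real t ^ n) =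
           of_real (Beta b d) * pochhammer (of_real b) n / pochhammer (of_real (b + d)) n"
proof -
  have "(LINT t|beta_measure b d. complex_of_real t ^ n) =
          complex_of_real (LINT t|beta_measure b d. t ^ n)"
    by (simp flip: integral_complex_of_real)
  also have "(LINT t|beta_measure b d. t ^ n) =
               (LINT t:{0<..<1}|lborel. t powr (b + real n - 1) * (1 - t) powr (d - 1))"
    by (subst integral_beta_measure, simp, intro set_lebesgue_integral_cong)
       (auto simp: powr_add powr_diff powr_realpow field_simps)
  also have "\<dots> = Beta (b + real n) d"
    using assms by (intro set_integral_Beta) auto
  finally show ?thesis
    using assms by (simp add: Beta_add_nat flip: pochhammer_of_real of_real_add)
qed

section \<open>Euler's integral on the slit plane\<close>

text \<open>Differentiation under the integral sign. By the mean value inequality a bound on the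
  derivative also bounds the difference quotients, so dominated convergence with a
  constant majorant applies to them along every sequence that tends to \<open>z\<close>.\<close>

lemma has_field_derivative_integral:
  fixes f f' :: "'a \<Rightarrow> complex \<Rightarrow> complex"
  assumes "finite_measure M" and "\<epsilon> > 0"
    and int: "\<And>w. w \<in> ball z \<epsilon> \<Longrightarrow> integrable M (\<lambda>t. f t w)"
    and meas: "(\<lambda>t. f' t z) \<in> borel_measurable M"
    and deriv: "AE t in M. \<forall>w\<in>ball z \<epsilon>. (f t has_field_derivative f' t w) (at w) \<and> norm (f' t w) \<le> B"
  shows "((\<lambda>w. LINT t|M. f t w) has_field_derivative (LINT t|M. f' t z)) (at z)"
proof -
  interpret finite_measure M by fact
  have z: "z \<in> ball z \<epsilon>" using \<open>\<epsilon> > 0\<close> by simp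
  define q where "q t w = (f t w - f t z) / (w - z)" for t w
  have eq: "(LINT t|M. q t w) = ((LINT t|M. f t w) - (LINT t|M. f t z)) / (w - z)"
    if "w \<in> ball z \<epsilon>" for w
    using int[OF that] int[OF z] by (simp add: q_def)
  have "((\<lambda>w. LINT t|M. q t w) \<longlongrightarrow> (LINT t|M. f' t z)) (at z within ball z \<epsilon>)"
    unfolding tendsto_at_iff_sequentially comp_def
  proof (intro allI impI)
    fix W assume W: "\<forall>i::nat. W i \<in> ball z \<epsilon> - {z}" and lim: "W \<longlonglongrightarrow> z"
    show "(\<lambda>i. LINT t|M. q t (W i)) \<longlonglongrightarrow> (LINT t|M. f' t z)"
    proof (rule integral_dominated_convergence[where w = "\<lambda>_. B"])
      show "(\<lambda>t. q t (W i)) \<in> borel_measurable M" for i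
        unfolding q_def using int[of "W i"] int[OF z] W by (intro borel_measurable_divide borel_measurable_diff) auto
      show "AE t in M. (\<lambda>i. q t (W i)) \<longlonglongrightarrow> f' t z"
        using deriv
      proof eventually_elim
        case (elim t)
        then have "(q t \<longlongrightarrow> f' t z) (at z)"
          using z unfolding q_def by (auto simp: has_field_derivative_iff)
        then show ?case
          using W lim unfolding tendsto_at_iff_sequentially comp_def by blast
      qed
      show "AE t in M. norm (q t (W i)) \<le> B" for i
        using deriv
      proof eventually_elim
        case (elim t)
        have "norm (f t (W i) - f t z) \<le> B * norm (W i - z)"
          by (rule field_differentiable_bound[OF convex_ball, of z \<epsilon> "f t" "f' t"])
             (use elim W z in \<open>auto intro: has_field_derivative_at_within\<close>)
        moreover have "norm (W i - z) > 0" using W by auto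
        ultimately show ?case
          by (simp add: q_def norm_divide divide_le_eq)
      qed
    qed (use meas in auto)
  qed
  then have "((\<lambda>w. LINT t|M. q t w) \<longlongrightarrow> (LINT t|M. f' t z)) (at z)"
    by (simp only: at_within_open[OF z open_ball])
  moreover have "\<forall>\<^sub>F w in at z. (LINT t|M. q t w) =
      ((LINT t|M. f t w) - (LINT t|M. f t z)) / (w - z)"
    using eventually_at_in_open'[OF open_ball z] by (rule eventually_mono) (rule eq)
  ultimately show ?thesis
    unfolding has_field_derivative_iff using tendsto_cong by fast
qed

text \<open>The slit plane is exactly the set of \<open>z\<close> for which the principal branch in
  \<open>(1 - z * t) powr a\<close> stays off its cut for all \<open>t\<close> in \<open>[0, 1]\<close>: if \<open>z * t\<close> is real and at
  least 1, then so is \<open>z\<close>.\<close>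

lemma one_minus_slit_plane:
  assumes "z \<in> slit_plane" "0 \<le> t" "t \<le> 1"
  shows "1 - z * of_real t \<notin> \<real>\<^sub>\<le>\<^sub>0"
proof
  assume "1 - z * of_real t \<in> \<real>\<^sub>\<le>\<^sub>0"
  then have *: "Im z * t = 0" "Re z * t \<ge> 1"
    by (auto simp: complex_nonpos_Reals_iff)
  then have "t \<noteq> 0" by auto
  with * have "Im z = 0" by simp
  moreover have "Re z \<ge> 1"
    using * \<open>0 \<le> t\<close> \<open>t \<le> 1\<close> mult_mono[of "Re z" 1 t 1] mult_left_mono[of t 1 "Re z"]
    by (smt (verit) mult_left_le mult_nonpos_nonneg)
  ultimately show False using assms(1) by (simp add: slit_plane_iff)
qed

lemma borel_measurable_powr_complex [measurable]:
  fixes f :: "'a \<Rightarrow> complex"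
  assumes [measurable]: "f \<in> borel_measurable M"
  shows "(\<lambda>x. f x powr a) \<in> borel_measurable M"
  unfolding powr_def by measurable

text \<open>Joint continuity on the compact set \<open>{0..1} \<times> C\<close> makes the bound uniform in \<open>w\<close>, as
  differentiation under the integral sign requires.\<close>

lemma bounded_powr_kernel:
  assumes "C \<subseteq> slit_plane" "compact C"
  shows "\<exists>B. \<forall>t\<in>{0..1}. \<forall>w\<in>C. norm ((1 - w * complex_of_real t) powr a) \<le> B"
proof -
  have "continuous_on ({0..1} \<times> C) (\<lambda>(t, w). (1 - w * complex_of_real t) powr a)"
    unfolding case_prod_unfold
  proof (rule continuous_on_compose2[where g = "\<lambda>z. z powr a" and t = "- \<real>\<^sub>\<le>\<^sub>0"])
    show "continuous_on (- \<real>\<^sub>\<le>\<^sub>0) (\<lambda>z. z powr a)"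
      by (rule DERIV_continuous_on) (auto intro: has_field_derivative_powr has_field_derivative_at_within)
    show "(\<lambda>x. 1 - snd x * complex_of_real (fst x)) ` ({0..1} \<times> C) \<subseteq> - \<real>\<^sub>\<le>\<^sub>0"
      using assms(1) one_minus_slit_plane by (force simp del: complex_nonpos_Reals_iff)
  qed (intro continuous_intros)
  then have "bounded ((\<lambda>(t, w). (1 - w * complex_of_real t) powr a) ` ({0..1} \<times> C))"
    using assms(2) by (intro compact_imp_bounded compact_continuous_image compact_Times) auto
  then obtain B where
    "\<forall>x\<in>(\<lambda>(t, w). (1 - w * complex_of_real t) powr a) ` ({0..1} \<times> C). norm x \<le> B"
    unfolding bounded_iff by blast
  then show ?thesis
    by (intro exI[of _ B]) auto
qed

lemma integrable_powr_kernel: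
  assumes "b > 0" "d > 0" "z \<in> slit_plane"
  shows "integrable (beta_measure b d) (\<lambda>t. (1 - z * complex_of_real t) powr a)"
proof -
  obtain B where "\<forall>t\<in>{0..1}. norm ((1 - z * complex_of_real t) powr a) \<le> B"
    using bounded_powr_kernel[of "{z}" a] assms by auto
  then have "AE t in beta_measure b d. norm ((1 - z * complex_of_real t) powr a) \<le> B"
    by (intro eventually_mono[OF AE_beta_measure]) auto
  then show ?thesis
    using finite_measure_beta_measure[OF assms(1,2)]
    by (intro finite_measure.integrable_const_bound) auto
qed

lemma holomorphic_Euler_integral:
  assumes "b > 0" "d > 0"
  shows "(\<lambda>z. LINT t|beta_measure b d. (1 - z * complex_of_real t) powr a) holomorphic_on slit_plane"
proof -
  have "(\<lambda>z. LINT t|beta_measure b d. (1 - z * complex_of_real t) powr a) field_differentiable at z"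
    if z: "z \<in> slit_plane" for z
  proof -
    obtain \<epsilon> where \<epsilon>: "\<epsilon> > 0" "cball z \<epsilon> \<subseteq> slit_plane"
      using open_contains_cball[THEN iffD1, OF open_slit_plane] z by blast
    obtain B where B: "\<forall>t\<in>{0..1}. \<forall>w\<in>cball z \<epsilon>.
        norm ((1 - w * complex_of_real t) powr (a - 1)) \<le> B"
      using bounded_powr_kernel[OF \<epsilon>(2) compact_cball, of "a - 1"] by blast
    define f' where "f' t w = - a * of_real t * (1 - w * complex_of_real t) powr (a - 1)" for t w
    have "((\<lambda>w. LINT t|beta_measure b d. (1 - w * complex_of_real t) powr a)
            has_field_derivative (LINT t|beta_measure b d. f' t z)) (at z)"
    proof (rule has_field_derivative_integral[OF finite_measure_beta_measure[OF assms] \<epsilon>(1),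
          where B = "norm a * B" and f = "\<lambda>t w. (1 - w * complex_of_real t) powr a" and f' = f'])
      show "AE t in beta_measure b d. \<forall>w\<in>ball z \<epsilon>.
          ((\<lambda>w. (1 - w * complex_of_real t) powr a) has_field_derivative f' t w) (at w) \<and>
          norm (f' t w) \<le> norm a * B"
        using AE_beta_measure
      proof eventually_elim
        case (elim t)
        show ?case
        proof (intro ballI conjI)
          fix w assume w: "w \<in> ball z \<epsilon>"
          then have "1 - w * complex_of_real t \<notin> \<real>\<^sub>\<le>\<^sub>0"
            using \<epsilon>(2) elim by (intro one_minus_slit_plane) auto
          then show "((\<lambda>w. (1 - w * complex_of_real t) powr a) has_field_derivative f' t w) (at w)"
            unfolding f'_def by (auto intro!: derivative_eq_intros)
          have "norm (of_real t * (1 - w * complex_of_real t) powr (a - 1)) \<le> 1 * B"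
            unfolding norm_mult using B w elim by (intro mult_mono) auto
          then show "norm (f' t w) \<le> norm a * B"
            unfolding f'_def by (simp add: norm_mult mult.assoc mult_left_mono)
        qed
      qed
      show "integrable (beta_measure b d) (\<lambda>t. (1 - w * complex_of_real t) powr a)"
        if "w \<in> ball z \<epsilon>" for w
        using \<epsilon>(2) that by (intro integrable_powr_kernel assms) auto
      show "(\<lambda>t. f' t z) \<in> borel_measurable (beta_measure b d)"
        unfolding f'_def by measurable
    qed
    then show ?thesis
      unfolding field_differentiable_def by blast
  qed
  then show ?thesis
    by (simp add: holomorphic_on_open[OF open_slit_plane] field_differentiable_def)
qed

section \<open>Euler's integral as the hypergeometric function\<close>

text \<open>The binomial series in the form that matches the hypergeometric coefficients. Its absolute
  convergence is compared with convergence at the midpoint between \<open>norm z\<close> and 1.\<close>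

lemma binomial_series_sums:
  fixes a z :: complex
  assumes "norm z < 1"
  shows "(\<lambda>n. pochhammer a n / fact n * z ^ n) sums (1 - z) powr (- a)"
    and "summable (\<lambda>n. norm (pochhammer a n / fact n * z ^ n))"
proof -
  have s: "(\<lambda>n. pochhammer a n / fact n * w ^ n) sums (1 - w) powr (- a)" if "norm w < 1" for w
  proof -
    have "((- a) gchoose n) * (- w) ^ n = pochhammer a n / fact n * w ^ n" for n
    proof -
      have "((- a) gchoose n) * (- w) ^ n = pochhammer a n / fact n * ((- 1) ^ n * (- w) ^ n)"
        by (simp add: gbinomial_pochhammer)
      also have "(- 1) ^ n * (- w) ^ n = w ^ n"
        by (simp flip: power_mult_distrib)
      finally show ?thesis .
    qed
    then show ?thesis
      using gen_binomial_complex[of "- w" "- a"] that by simp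
  qed
  show "(\<lambda>n. pochhammer a n / fact n * z ^ n) sums (1 - z) powr (- a)"
    by (rule s[OF assms])
  define \<rho> where "\<rho> = (1 + norm z) / 2"
  have \<rho>: "norm (complex_of_real \<rho>) < 1" "norm z < norm (complex_of_real \<rho>)"
    using assms norm_ge_zero[of z] by (simp_all add: \<rho>_def del: of_real_divide of_real_add)
  have "summable (\<lambda>n. pochhammer a n / fact n * complex_of_real \<rho> ^ n)"
    by (rule sums_summable[OF s[OF \<rho>(1)]])
  then show "summable (\<lambda>n. norm (pochhammer a n / fact n * z ^ n))"
    using \<rho>(2) by (rule powser_insidea)
qed

text \<open>Termwise integration of the binomial series of \<open>(1 - z * t) powr (- a)\<close>: the \<open>n\<close>-th moment of
  the beta measure supplies the quotient of the Pochhammer symbols of \<open>b\<close> and \<open>b + d\<close>. For \<open>t < 1\<close> the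
  terms are dominated by those at \<open>t = 1\<close>, which justifies the exchange.\<close>

lemma Euler_integral_series:
  assumes "b > 0" "d > 0" "norm z < 1"
  shows "(LINT t|beta_measure b d. (1 - z * complex_of_real t) powr (- a)) =
           of_real (Beta b d) * hyp2F1_series a (of_real b) (of_real (b + d)) z"
proof -
  interpret finite_measure "beta_measure b d"
    by (rule finite_measure_beta_measure[OF assms(1,2)])
  define f where "f n t = pochhammer a n / fact n * (z * complex_of_real t) ^ n" for n t
  have bound: "norm (f n t) \<le> norm (pochhammer a n / fact n * z ^ n)" if "0 < t" "t < 1" for n t
  proof -
    have "norm (f n t) = norm (pochhammer a n / fact n * z ^ n) * t ^ n"
      using that by (simp add: f_def norm_mult norm_divide norm_power power_mult_distrib)
    also have "\<dots> \<le> norm (pochhammer a n / fact n * z ^ n)"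
      using that by (intro mult_left_le power_le_one) auto
    finally show ?thesis .
  qed
  have meas [measurable]: "f n \<in> borel_measurable borel" for n
    unfolding f_def by measurable
  have int: "integrable (beta_measure b d) (f n)" for n
    by (intro integrable_const_bound[where B = "norm (pochhammer a n / fact n * z ^ n)"]
          eventually_mono[OF AE_beta_measure] bound) auto
  have sm: "summable (\<lambda>n. norm (pochhammer a n / fact n * z ^ n))"
    by (rule binomial_series_sums[OF assms(3)])
  have "(\<lambda>n. LINT t|beta_measure b d. f n t) sums (LINT t|beta_measure b d. (\<Sum>n. f n t))"
  proof (rule sums_integral[OF int])
    show "AE t in beta_measure b d. summable (\<lambda>n. norm (f n t))"
      using AE_beta_measure
    proof eventually_elim
      case (elim t)
      show ?case
        by (rule summable_comparison_test'[OF sm, of 0]) (use bound elim in simp)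
    qed
    show "summable (\<lambda>n. LINT t|beta_measure b d. norm (f n t))"
    proof (rule summable_comparison_test_ev)
      show "summable (\<lambda>n. norm (pochhammer a n / fact n * z ^ n) * measure (beta_measure b d) UNIV)"
        using sm by (rule summable_mult2)
      have "norm (LINT t|beta_measure b d. norm (f n t)) \<le>
              norm (pochhammer a n / fact n * z ^ n) * measure (beta_measure b d) UNIV" for n
      proof -
        have "(LINT t|beta_measure b d. norm (f n t)) \<le>
                (LINT t|beta_measure b d. norm (pochhammer a n / fact n * z ^ n))"
          using int[of n]
          by (intro integral_mono_AE eventually_mono[OF AE_beta_measure] bound) auto
        then show ?thesis
          by (simp add: integral_nonneg beta_measure_def mult_ac)
      qed
      then show "\<forall>\<^sub>F n in sequentially. norm (LINT t|beta_measure b d. norm (f n t)) \<le>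
              norm (pochhammer a n / fact n * z ^ n) * measure (beta_measure b d) UNIV"
        by (simp add: always_eventually)
    qed
  qed
  moreover have "(LINT t|beta_measure b d. (\<Sum>n. f n t)) =
      (LINT t|beta_measure b d. (1 - z * complex_of_real t) powr (- a))"
  proof (rule integral_cong_AE)
    show "AE t in beta_measure b d. (\<Sum>n. f n t) = (1 - z * complex_of_real t) powr (- a)"
      using AE_beta_measure
    proof eventually_elim
      case (elim t)
      have "norm (z * of_real t) \<le> norm z"
        using elim by (simp add: norm_mult mult_left_le)
      then show ?case
        unfolding f_def using assms(3) by (intro sums_unique[symmetric] binomial_series_sums) auto
    qed
  qed simp_all
  moreover have "(LINT t|beta_measure b d. f n t) = of_real (Beta b d) *
      (pochhammer a n * pochhammer (of_real b) n / pochhammer (of_real (b + d)) n * (z ^ n / fact n))" for n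
    unfolding f_def power_mult_distrib
    using integral_power_beta_measure[OF assms(1,2), of n] by simp
  ultimately have "(\<lambda>n. of_real (Beta b d) *
      (pochhammer a n * pochhammer (of_real b) n / pochhammer (of_real (b + d)) n * (z ^ n / fact n)))
      sums (LINT t|beta_measure b d. (1 - z * complex_of_real t) powr (- a))"
    by simp
  moreover have "Beta b d > 0"
    using assms by (intro Beta_real_pos)
  ultimately show ?thesis
    unfolding hyp2F1_series_def by (subst suminf_mult[symmetric]) (auto simp: sums_iff summable_mult_D)
qed

text \<open>The normalised integral is holomorphic on the slit plane and agrees with the series on the
  disc; by uniqueness of analytic continuation it is the hypergeometric function.\<close>

lemma hyp2F1_Euler_integral:
  assumes "b > 0" "d > 0" "z \<in> slit_plane"
  shows "of_real (Beta b d) * hyp2F1 a (of_real b) (of_real (b + d)) z =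
           (LINT t|beta_measure b d. (1 - z * complex_of_real t) powr (- a))"
proof -
  have nz: "Beta b d \<noteq> 0"
    using Beta_real_pos[OF assms(1,2)] by simp
  define F where "F z = (LINT t|beta_measure b d. (1 - z * complex_of_real t) powr (- a)) / of_real (Beta b d)" for z
  have "hyp2F1 a (of_real b) (of_real (b + d)) z = F z"
  proof (rule hyp2F1_eqI[OF _ _ assms(3)])
    show "F holomorphic_on slit_plane"
      unfolding F_def using nz assms by (intro holomorphic_intros holomorphic_Euler_integral) auto
    show "F u = hyp2F1_series a (of_real b) (of_real (b + d)) u" if "norm u < 1" for u
      using nz Euler_integral_series[OF assms(1,2) that] by (simp add: F_def)
  qed
  then show ?thesis
    using nz by (simp add: F_def)
qed

text \<open>At \<open>z = -1\<close> and for real \<open>a\<close> the kernel is the real power \<open>(1 + t) powr (- a)\<close>, which brings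
  Euler's integral back to real integration.\<close>

lemma hyp2F1_minus_one:
  fixes a b d :: real
  assumes "b > 0" "d > 0"
  shows "set_integrable lborel {0<..<1} (\<lambda>t. t powr (b - 1) * (1 - t) powr (d - 1) * (1 + t) powr (- a))"
    and "of_real (Beta b d) * hyp2F1 (of_real a) (of_real b) (of_real (b + d)) (-1) =
           complex_of_real (LINT t:{0<..<1}|lborel. t powr (b - 1) * (1 - t) powr (d - 1) * (1 + t) powr (- a))"
proof -
  have slit: "-1 \<in> slit_plane"
    by (simp add: slit_plane_iff)
  have meas [measurable]: "(\<lambda>t::real. (1 + t) powr (- a)) \<in> borel_measurable borel"
    by measurable
  have real: "AE t in beta_measure b d.
      (1 - (-1) * complex_of_real t) powr (- of_real a) = of_real ((1 + t) powr (- a))"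
    using AE_beta_measure
  proof eventually_elim
    case (elim t)
    have "1 - (-1) * complex_of_real t = of_real (1 + t)" "- complex_of_real a = of_real (- a)"
      by simp_all
    then show ?case
      using elim by (simp only:) (rule powr_of_real, simp)
  qed
  have "integrable (beta_measure b d) (\<lambda>t. complex_of_real ((1 + t) powr (- a)))"
    by (rule integrable_cong_AE_imp[OF integrable_powr_kernel[OF assms slit]]) (use real in auto)
  then have "integrable (beta_measure b d) (\<lambda>t. (1 + t) powr (- a))"
    by (simp add: complex_of_real_integrable_eq)
  then show "set_integrable lborel {0<..<1} (\<lambda>t. t powr (b - 1) * (1 - t) powr (d - 1) * (1 + t) powr (- a))"
    by (simp add: integral_beta_measure)
  have "of_real (Beta b d) * hyp2F1 (of_real a) (of_real b) (of_real (b + d)) (-1) =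
      (LINT t|beta_measure b d. (1 - (-1) * complex_of_real t) powr (- of_real a))"
    by (rule hyp2F1_Euler_integral[OF assms slit])
  also have "\<dots> = (LINT t|beta_measure b d. complex_of_real ((1 + t) powr (- a)))"
    by (rule integral_cong_AE[OF _ _ real]) auto
  also have "\<dots> = complex_of_real (LINT t|beta_measure b d. (1 + t) powr (- a))"
    by simp
  finally show "of_real (Beta b d) * hyp2F1 (of_real a) (of_real b) (of_real (b + d)) (-1) =
      complex_of_real (LINT t:{0<..<1}|lborel. t powr (b - 1) * (1 - t) powr (d - 1) * (1 + t) powr (- a))"
    by (simp add: integral_beta_measure)
qed

section \<open>Termwise integration of the logarithm\<close>

text \<open>Partial sums of a nonnegative series are dominated by its sum, so integrability of the sum is all
  that termwise integration needs.\<close>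

lemma sums_integral_nonneg:
  fixes f :: "nat \<Rightarrow> 'a \<Rightarrow> real"
  assumes f: "\<And>n. integrable M (f n)" and nonneg: "\<And>n. AE x in M. 0 \<le> f n x"
    and sums: "AE x in M. (\<lambda>n. f n x) sums g x" and g: "integrable M g"
  shows "(\<lambda>n. integral\<^sup>L M (f n)) sums integral\<^sup>L M g"
proof -
  have nonneg': "AE x in M. \<forall>n. 0 \<le> f n x"
    using nonneg by (simp add: AE_all_countable)
  have "(\<lambda>N. LINT x|M. (\<Sum>n<N. f n x)) \<longlonglongrightarrow> integral\<^sup>L M g"
  proof (rule integral_dominated_convergence[where w = g])
    show "AE x in M. (\<lambda>N. \<Sum>n<N. f n x) \<longlonglongrightarrow> g x"
      using sums by (simp add: sums_def)
    show "AE x in M. norm (\<Sum>n<N. f n x) \<le> g x" for N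
      using sums nonneg'
    proof eventually_elim
      case (elim x)
      have "(\<Sum>n<N. f n x) \<le> (\<Sum>n. f n x)"
        using elim by (intro sum_le_suminf) (auto simp: sums_iff)
      then show ?case
        using elim by (simp add: sums_iff sum_nonneg)
    qed
  qed (use f g in auto)
  then show ?thesis
    using f by (simp add: sums_def)
qed

lemma ln_ratio_sums:
  fixes t :: real
  assumes "0 < t" "t < 1"
  shows "(\<lambda>n. 2 / (2 * real n + 1) * t ^ (2 * n + 1)) sums ln ((1 + t) / (1 - t))"
proof -
  have "((1 + t) / (1 - t) - 1) / ((1 + t) / (1 - t) + 1) = t"
    using assms by (simp add: divide_simps)
  then show ?thesis
    using ln_series_quadratic[of "(1 + t) / (1 - t)"] assms by (simp add: add_ac mult_ac)
qed

text \<open>The logarithm of \<open>(1 + t) / (1 - t)\<close> is bounded by a multiple of any positive power of that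
  quotient. The power \<open>\<alpha> / 2\<close> raises the singularity at 1 from \<open>(1 - t) powr (\<alpha> - 1)\<close> only to
  \<open>(1 - t) powr (\<alpha> / 2 - 1)\<close>, which is still integrable.\<close>

lemma integrable_log_kernel:
  fixes \<alpha> s :: real
  assumes "\<alpha> > 0" "s > -1"
  shows "set_integrable lborel {0<..<1}
    (\<lambda>t. t powr s * (1 - t) powr (\<alpha> - 1) * (1 + t) powr (- (\<alpha> + 1)) * ln ((1 + t) / (1 - t)))"
proof (rule set_integrable_bound)
  show "set_integrable lborel {0<..<1}
    (\<lambda>t. 2 / \<alpha> * (t powr (s + 1 - 1) * (1 - t) powr (\<alpha> / 2 - 1) * (1 + t) powr (- (\<alpha> / 2 + 1))))"
    using assms by (intro set_integrable_mult_right hyp2F1_minus_one) auto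
  show "AE t in lborel. t \<in> {0<..<1} \<longrightarrow>
     norm (t powr s * (1 - t) powr (\<alpha> - 1) * (1 + t) powr (- (\<alpha> + 1)) * ln ((1 + t) / (1 - t)))
     \<le> norm (2 / \<alpha> * (t powr (s + 1 - 1) * (1 - t) powr (\<alpha> / 2 - 1) * (1 + t) powr (- (\<alpha> / 2 + 1))))"
  proof (intro AE_I2 impI)
    fix t :: real assume "t \<in> {0<..<1}"
    then have t: "0 < t" "t < 1" by auto
    define w where "w = t powr s * (1 - t) powr (\<alpha> - 1) * (1 + t) powr (- (\<alpha> + 1))"
    have "1 \<le> (1 + t) / (1 - t)"
      using t by simp
    then have ln: "0 \<le> ln ((1 + t) / (1 - t))"
             "ln ((1 + t) / (1 - t)) \<le> ((1 + t) / (1 - t)) powr (\<alpha> / 2) / (\<alpha> / 2)"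
      using ln_powr_bound[of "(1 + t) / (1 - t)" "\<alpha> / 2"] assms by simp_all
    have "w \<ge> 0" by (simp add: w_def)
    then have "norm (w * ln ((1 + t) / (1 - t))) = w * ln ((1 + t) / (1 - t))"
      using ln(1) by simp
    also have "\<dots> \<le> w * (((1 + t) / (1 - t)) powr (\<alpha> / 2) / (\<alpha> / 2))"
      using ln(2) \<open>w \<ge> 0\<close> by (rule mult_left_mono)
    also have "\<dots> = 2 / \<alpha> * (t powr s * ((1 - t) powr (\<alpha> - 1) / (1 - t) powr (\<alpha> / 2)) *
                        ((1 + t) powr (- (\<alpha> + 1)) * (1 + t) powr (\<alpha> / 2)))"
      using t by (simp add: w_def powr_divide mult_ac)
    also have "(1 - t) powr (\<alpha> - 1) / (1 - t) powr (\<alpha> / 2) = (1 - t) powr (\<alpha> / 2 - 1)"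
      by (simp flip: powr_diff)
    also have "(1 + t) powr (- (\<alpha> + 1)) * (1 + t) powr (\<alpha> / 2) = (1 + t) powr (- (\<alpha> / 2 + 1))"
      by (simp flip: powr_add)
    finally show "norm (t powr s * (1 - t) powr (\<alpha> - 1) * (1 + t) powr (- (\<alpha> + 1)) * ln ((1 + t) / (1 - t)))
       \<le> norm (2 / \<alpha> * (t powr (s + 1 - 1) * (1 - t) powr (\<alpha> / 2 - 1) * (1 + t) powr (- (\<alpha> / 2 + 1))))"
      using assms by (simp add: w_def abs_mult)
  qed
qed (auto simp: set_borel_measurable_def)

lemma log_kernel_sums:
  fixes \<alpha> s :: real
  assumes "\<alpha> > 0" "s > -1"
  shows "(\<lambda>n. 2 / (2 * real n + 1) *
            (LINT t:{0<..<1}|lborel. t powr (s + (2 * real n + 1)) * (1 - t) powr (\<alpha> - 1) * (1 + t) powr (- (\<alpha> + 1))))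
         sums (LINT t:{0<..<1}|lborel.
            t powr s * (1 - t) powr (\<alpha> - 1) * (1 + t) powr (- (\<alpha> + 1)) * ln ((1 + t) / (1 - t)))"
proof -
  define w where "w s t = t powr s * (1 - t) powr (\<alpha> - 1) * (1 + t) powr (- (\<alpha> + 1))" for s t :: real
  have "(\<lambda>n. LINT t|lborel. indicator {0<..<1} t *\<^sub>R (2 / (2 * real n + 1) * w (s + (2 * real n + 1)) t))
         sums (LINT t|lborel. indicator {0<..<1} t *\<^sub>R (w s t * ln ((1 + t) / (1 - t))))"
  proof (rule sums_integral_nonneg)
    show "integrable lborel (\<lambda>t. indicator {0<..<1} t *\<^sub>R (2 / (2 * real n + 1) * w (s + (2 * real n + 1)) t))" for n
      using hyp2F1_minus_one(1)[of "s + (2 * real n + 1) + 1" \<alpha> "\<alpha> + 1", unfolded add_diff_cancel_right'] assms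
      unfolding w_def by (intro set_integrable_mult_right[unfolded set_integrable_def]) (simp add: set_integrable_def)
    show "integrable lborel (\<lambda>t. indicator {0<..<1} t *\<^sub>R (w s t * ln ((1 + t) / (1 - t))))"
      using integrable_log_kernel[OF assms] by (simp add: w_def set_integrable_def)
    show "AE t in lborel. (\<lambda>n. indicator {0<..<1} t *\<^sub>R (2 / (2 * real n + 1) * w (s + (2 * real n + 1)) t))
        sums (indicator {0<..<1} t *\<^sub>R (w s t * ln ((1 + t) / (1 - t))))"
    proof (intro AE_I2)
      fix t :: real
      show "(\<lambda>n. indicator {0<..<1} t *\<^sub>R (2 / (2 * real n + 1) * w (s + (2 * real n + 1)) t))
          sums (indicator {0<..<1} t *\<^sub>R (w s t * ln ((1 + t) / (1 - t))))"
      proof (cases "0 < t \<and> t < 1")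
        case True
        \<comment> \<open>an odd power from the logarithm is absorbed into the power of \<open>t\<close> in the weight\<close>
        have "t powr (2 * real n + 1) = t ^ (2 * n + 1)" for n
          using True powr_realpow[of t "2 * n + 1"] by (simp add: add_ac)
        then have "w (s + (2 * real n + 1)) t = w s t * t ^ (2 * n + 1)" for n
          by (simp add: w_def powr_add[of t s])
        then show ?thesis
          using sums_mult[OF ln_ratio_sums[of t], of "w s t"] True by (simp add: mult_ac)
      qed auto
    qed
    show "AE t in lborel. 0 \<le> indicator {0<..<1} t *\<^sub>R (2 / (2 * real n + 1) * w (s + (2 * real n + 1)) t)" for n
      by (auto simp: w_def)
  qed
  then show ?thesis
    by (simp add: set_lebesgue_integral_def w_def mult.left_commute[of "indicator _ _"])
qed

section \<open>The moments of the distribution\<close>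

text \<open>For \<open>\<beta> < 1\<close> the derivative of \<open>x powr \<beta>\<close> is unbounded at 0, so the substitution is made on the
  open interval, by the change of variables theorem for injective differentiable maps. That theorem concerns
  Lebesgue measurable functions; Borel measurability of \<open>f\<close> transfers its conclusion to \<open>lborel\<close>.\<close>

lemma set_integral_substitution_powr:
  fixes \<beta> :: real and F f :: "real \<Rightarrow> real"
  assumes "\<beta> > 0"
    and F: "set_integrable lborel {0<..<1} F"
    and [measurable]: "f \<in> borel_measurable borel"
    and f: "\<And>x. 0 < x \<Longrightarrow> x < 1 \<Longrightarrow> f x = \<beta> * x powr (\<beta> - 1) * F (x powr \<beta>)"
  shows "set_integrable lborel {0<..<1} f"
    and "(LINT x:{0<..<1}|lborel. f x) = (LINT t:{0<..<1}|lborel. F t)"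
proof -
  have image: "(\<lambda>x. x powr \<beta>) ` {0<..<1} = {0<..<1::real}"
  proof (intro equalityI subsetI)
    fix t :: real assume "t \<in> {0<..<1}"
    then have "t = (t powr (1 / \<beta>)) powr \<beta>" "t powr (1 / \<beta>) \<in> {0<..<1}"
      using assms(1) powr_less_mono2[of "1 / \<beta>" t 1] by (auto simp: powr_powr)
    then show "t \<in> (\<lambda>x. x powr \<beta>) ` {0<..<1}" by blast
  qed (use assms(1) powr_less_mono2[of \<beta> _ 1] in auto)
  have inj: "inj_on (\<lambda>x. x powr \<beta>) {0<..<1::real}"
    using assms(1) by (intro inj_on_inverseI[where g = "\<lambda>t. t powr (1 / \<beta>)"]) (auto simp: powr_powr)
  have F': "F absolutely_integrable_on {0<..<1}"
    using F by (simp add: set_integrable_def integrable_completion borel_measurable_integrable)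
  have "(\<lambda>x. \<bar>\<beta> * x powr (\<beta> - 1)\<bar> * F (x powr \<beta>)) absolutely_integrable_on {0<..<1} \<and>
        integral {0<..<1} (\<lambda>x. \<bar>\<beta> * x powr (\<beta> - 1)\<bar> * F (x powr \<beta>)) = integral {0<..<1} F"
    by (subst has_absolute_integral_change_of_variables_1'[OF _ _ inj])
       (auto simp: image F' intro!: derivative_eq_intros)
  moreover have "f absolutely_integrable_on {0<..<1} \<longleftrightarrow>
      (\<lambda>x. \<bar>\<beta> * x powr (\<beta> - 1)\<bar> * F (x powr \<beta>)) absolutely_integrable_on {0<..<1}"
    using f assms(1) by (intro set_integrable_cong) (auto simp: abs_mult)
  moreover have "integral {0<..<1} f = integral {0<..<1} (\<lambda>x. \<bar>\<beta> * x powr (\<beta> - 1)\<bar> * F (x powr \<beta>))"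
    using f assms(1) by (intro integral_cong) (auto simp: abs_mult)
  ultimately have *: "f absolutely_integrable_on {0<..<1}" "integral {0<..<1} f = integral {0<..<1} F"
    by auto
  from *(1) show int: "set_integrable lborel {0<..<1} f"
    by (simp add: set_integrable_def integrable_completion)
  show "(LINT x:{0<..<1}|lborel. f x) = (LINT t:{0<..<1}|lborel. F t)"
    using *(2) by (simp add: set_borel_integral_eq_integral(2)[OF int] set_borel_integral_eq_integral(2)[OF F])
qed

text \<open>The factor \<open>\<beta> * x powr (\<beta> - 1)\<close> of the density is the derivative of \<open>x powr \<beta>\<close>; everything else
  is a function of \<open>t = x powr \<beta>\<close>, since \<open>x ^ r = t powr (r / \<beta>)\<close>.\<close>

lemma rtuomg_density_substitution:
  assumes "\<alpha> > 0" "\<beta> > 0" "0 < x" "x < 1"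
  shows "x ^ r * rtuomg_density \<alpha> \<beta> p x = \<beta> * x powr (\<beta> - 1) *
     (let t = x powr \<beta>; w = t powr (real r / \<beta>) * (1 - t) powr (\<alpha> - 1) * (1 + t) powr (- (\<alpha> + 1))
      in 2 * \<alpha> * (1 - p) * w + 2 * \<alpha>\<^sup>2 * p * (w * ln ((1 + t) / (1 - t))))"
proof -
  define t where "t = x powr \<beta>"
  have t: "0 < t" "t < 1"
    using assms powr_less_mono2[of \<beta> x 1] by (auto simp: t_def)
  have "x ^ r = t powr (real r / \<beta>)"
    using assms by (simp add: t_def powr_powr powr_realpow)
  moreover have "x powr (2 * \<beta>) = t\<^sup>2"
    using assms by (simp add: t_def powr_powr mult_ac flip: powr_numeral)
  moreover have "ln (omega \<alpha> \<beta> x) = - \<alpha> * ln ((1 + t) / (1 - t))"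
    using t by (simp add: omega_def ln_powr flip: t_def)
  moreover have "omega \<alpha> \<beta> x / (1 - t\<^sup>2) = (1 - t) powr (\<alpha> - 1) * (1 + t) powr (- (\<alpha> + 1))"
    using t by (simp add: omega_def powr_divide powr_minus powr_diff powr_add power2_eq_square field_simps flip: t_def)
  moreover have "x ^ r * rtuomg_density \<alpha> \<beta> p x = 2 * \<alpha> * \<beta> * x powr (\<beta> - 1) * x ^ r *
      (omega \<alpha> \<beta> x / (1 - x powr (2 * \<beta>))) * (1 - p - p * ln (omega \<alpha> \<beta> x))"
    using assms by (simp add: rtuomg_density_def)
  ultimately have "x ^ r * rtuomg_density \<alpha> \<beta> p x = 2 * \<alpha> * \<beta> * x powr (\<beta> - 1) * t powr (real r / \<beta>) *
      ((1 - t) powr (\<alpha> - 1) * (1 + t) powr (- (\<alpha> + 1))) * (1 - p - p * (- \<alpha> * ln ((1 + t) / (1 - t))))"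
    by simp
  then show ?thesis
    unfolding Let_def t_def[symmetric] by (simp add: algebra_simps power2_eq_square)
qed

lemma rtuomg_density_nonneg:
  assumes "\<alpha> > 0" "\<beta> > 0" "0 \<le> p" "p \<le> 1"
  shows "rtuomg_density \<alpha> \<beta> p x \<ge> 0"
proof (cases "0 < x \<and> x < 1")
  case True
  define t where "t = x powr \<beta>"
  have t: "0 < t" "t < 1"
    using True assms powr_less_mono2[of \<beta> x 1] by (auto simp: t_def)
  then have "0 \<le> ln ((1 + t) / (1 - t))"
    by (intro ln_ge_zero) auto
  then have "0 \<le> - (p * ln (omega \<alpha> \<beta> x))"
    using t assms by (simp add: omega_def ln_powr flip: t_def)
  moreover have "x powr (2 * \<beta>) < 1"
    using True assms powr_less_mono2[of "2 * \<beta>" x 1] by simp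
  moreover have "0 \<le> omega \<alpha> \<beta> x"
    by (simp add: omega_def)
  ultimately show ?thesis
    using True assms by (auto simp: rtuomg_density_def intro!: mult_nonneg_nonneg divide_nonneg_nonneg)
qed (auto simp: rtuomg_density_def)

lemma rtuomg_moment_integral:
  fixes \<alpha> \<beta> p :: real and r :: nat
  assumes "\<alpha> > 0" "\<beta> > 0"
  defines "w \<equiv> \<lambda>t. t powr (real r / \<beta>) * (1 - t) powr (\<alpha> - 1) * (1 + t) powr (- (\<alpha> + 1))"
  shows "set_integrable lborel {0<..<1} (\<lambda>x. x ^ r * rtuomg_density \<alpha> \<beta> p x)"
    and "(LINT x:{0<..<1}|lborel. x ^ r * rtuomg_density \<alpha> \<beta> p x) =
           2 * \<alpha> * (1 - p) * (LINT t:{0<..<1}|lborel. w t)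
           + 2 * \<alpha>\<^sup>2 * p * (LINT t:{0<..<1}|lborel. w t * ln ((1 + t) / (1 - t)))"
proof -
  define F where "F t = 2 * \<alpha> * (1 - p) * w t + 2 * \<alpha>\<^sup>2 * p * (w t * ln ((1 + t) / (1 - t)))" for t
  have s: "real r / \<beta> > -1"
    using assms by (simp add: less_le_trans[of _ 0])
  have w: "set_integrable lborel {0<..<1} w"
    using hyp2F1_minus_one(1)[of "real r / \<beta> + 1" \<alpha> "\<alpha> + 1"] assms s by (simp add: w_def)
  have wl: "set_integrable lborel {0<..<1} (\<lambda>t. w t * ln ((1 + t) / (1 - t)))"
    using integrable_log_kernel[OF assms(1) s] by (simp add: w_def)
  have F: "set_integrable lborel {0<..<1} F"
    unfolding F_def using w wl by (intro set_integral_add set_integrable_mult_right) auto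
  have meas: "(\<lambda>x. x ^ r * rtuomg_density \<alpha> \<beta> p x) \<in> borel_measurable borel"
    unfolding rtuomg_density_def omega_def by measurable
  have eq: "x ^ r * rtuomg_density \<alpha> \<beta> p x = \<beta> * x powr (\<beta> - 1) * F (x powr \<beta>)"
    if "0 < x" "x < 1" for x
    using rtuomg_density_substitution[OF assms(1,2) that] by (simp add: F_def w_def Let_def)
  show "set_integrable lborel {0<..<1} (\<lambda>x. x ^ r * rtuomg_density \<alpha> \<beta> p x)"
    by (rule set_integral_substitution_powr(1)[OF assms(2) F meas eq])
  have "(LINT x:{0<..<1}|lborel. x ^ r * rtuomg_density \<alpha> \<beta> p x) = (LINT t:{0<..<1}|lborel. F t)"
    by (rule set_integral_substitution_powr(2)[OF assms(2) F meas eq])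
  also have "\<dots> = 2 * \<alpha> * (1 - p) * (LINT t:{0<..<1}|lborel. w t)
           + 2 * \<alpha>\<^sup>2 * p * (LINT t:{0<..<1}|lborel. w t * ln ((1 + t) / (1 - t)))"
    unfolding F_def using w wl by (subst set_integral_add) (auto intro!: set_integrable_mult_right)
  finally show "(LINT x:{0<..<1}|lborel. x ^ r * rtuomg_density \<alpha> \<beta> p x) =
           2 * \<alpha> * (1 - p) * (LINT t:{0<..<1}|lborel. w t)
           + 2 * \<alpha>\<^sup>2 * p * (LINT t:{0<..<1}|lborel. w t * ln ((1 + t) / (1 - t)))" .
qed

theorem proposition2p1:
  fixes M :: "'a measure" and X :: "'a \<Rightarrow> real" and \<alpha> \<beta> p :: real and r :: nat
  assumes "prob_space M"
    and "\<alpha> > 0" and "\<beta> > 0" and "0 \<le> p" and "p \<le> 1"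
    and "RTUOMG M X \<alpha> \<beta> p"
    and "r \<ge> 1"
  shows "integrable M (\<lambda>w. X w ^ r)
       \<and> set_integrable lborel {0<..<1} (\<lambda>x. x ^ r * rtuomg_density \<alpha> \<beta> p x)
       \<and> ((LINT w|M. X w ^ r) = (LINT x:{0<..<1}|lborel. x ^ r * rtuomg_density \<alpha> \<beta> p x))
       \<and> summable (\<lambda>n. let k = n + 1 in
           complex_of_real (1 / (2 * real k - 1) * Beta (real r / \<beta> + 2 * real k) \<alpha>)
           * hyp2F1 (of_real (\<alpha> + 1)) (of_real (real r / \<beta> + 2 * real k))
               (of_real (real r / \<beta> + 2 * real k + \<alpha>)) (-1))
       \<and> (complex_of_real (LINT w|M. X w ^ r) =
           of_real (2 * \<alpha> * (1 - p) * Beta (real r / \<beta> + 1) \<alpha>)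
             * hyp2F1 (of_real (\<alpha> + 1)) (of_real (real r / \<beta> + 1))
                 (of_real (real r / \<beta> + \<alpha> + 1)) (-1)
           + of_real (4 * p * \<alpha>\<^sup>2)
             * (\<Sum>n. let k = n + 1 in
                  complex_of_real (1 / (2 * real k - 1) * Beta (real r / \<beta> + 2 * real k) \<alpha>)
                  * hyp2F1 (of_real (\<alpha> + 1)) (of_real (real r / \<beta> + 2 * real k))
                      (of_real (real r / \<beta> + 2 * real k + \<alpha>)) (-1)))"
proof -
  define s where "s = real r / \<beta>"
  have s: "s \<ge> 0" "s > -1"
    using assms by (auto simp: s_def less_le_trans[of _ 0])
  define I where "I c = (LINT t:{0<..<1}|lborel. t powr c * (1 - t) powr (\<alpha> - 1) * (1 + t) powr (- (\<alpha> + 1)))" for c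
  define L where "L = (LINT t:{0<..<1}|lborel.
      t powr s * (1 - t) powr (\<alpha> - 1) * (1 + t) powr (- (\<alpha> + 1)) * ln ((1 + t) / (1 - t)))"
  define T where "T = (\<lambda>n. let k = n + 1 in
      complex_of_real (1 / (2 * real k - 1) * Beta (s + 2 * real k) \<alpha>)
        * hyp2F1 (of_real (\<alpha> + 1)) (of_real (s + 2 * real k)) (of_real (s + 2 * real k + \<alpha>)) (-1))"
  have euler: "of_real (Beta b \<alpha>) * hyp2F1 (of_real (\<alpha> + 1)) (of_real b) (of_real (b + \<alpha>)) (-1) =
      complex_of_real (I (b - 1))" if "b > 0" for b
    using hyp2F1_minus_one(2)[OF that assms(2), of "\<alpha> + 1"] by (simp add: I_def)
  \<comment> \<open>With \<open>k = n + 1\<close> the odd number \<open>2 * k - 1\<close> is \<open>2 * n + 1\<close>. The factor 2 of the logarithm series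
     is split off here; together with \<open>2 * \<alpha>\<^sup>2 * p\<close> it gives the coefficient \<open>4 * p * \<alpha>\<^sup>2\<close>.\<close>
  have T: "T n = of_real (1 / 2 * (2 / (2 * real n + 1) * I (s + (2 * real n + 1))))" for n
  proof -
    have "T n = of_real (1 / (2 * real n + 1)) * (of_real (Beta (s + (2 * real n + 2)) \<alpha>) *
        hyp2F1 (of_real (\<alpha> + 1)) (of_real (s + (2 * real n + 2))) (of_real (s + (2 * real n + 2) + \<alpha>)) (-1))"
      by (simp add: T_def Let_def add_ac mult_ac)
    also have "\<dots> = of_real (1 / (2 * real n + 1)) * of_real (I (s + (2 * real n + 2) - 1))"
      using s by (subst euler) auto
    also have "s + (2 * real n + 2) - 1 = s + (2 * real n + 1)"
      by simp
    finally show ?thesis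
      by simp
  qed
  have "(\<lambda>n. 2 / (2 * real n + 1) * I (s + (2 * real n + 1))) sums L"
    unfolding I_def L_def by (rule log_kernel_sums[OF assms(2) s(2)])
  from sums_of_real[OF sums_mult[OF this, of "1 / 2"], where 'a = complex]
  have sums: "T sums of_real (L / 2)"
    unfolding T[abs_def] by simp
  have dens: "distributed M lborel X (\<lambda>x. ennreal (rtuomg_density \<alpha> \<beta> p x))"
    using assms(6) by (simp add: RTUOMG_def)
  have nonneg: "\<And>x. x \<in> space lborel \<Longrightarrow> 0 \<le> rtuomg_density \<alpha> \<beta> p x"
    using assms by (intro rtuomg_density_nonneg)
  have ind: "(\<lambda>x. rtuomg_density \<alpha> \<beta> p x * x ^ r) =
      (\<lambda>x. indicator {0<..<1} x *\<^sub>R (x ^ r * rtuomg_density \<alpha> \<beta> p x))"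
    by (auto simp: fun_eq_iff indicator_def rtuomg_density_def)
  have int: "set_integrable lborel {0<..<1} (\<lambda>x. x ^ r * rtuomg_density \<alpha> \<beta> p x)"
    by (rule rtuomg_moment_integral(1)[OF assms(2,3)])
  have integ: "integrable M (\<lambda>w. X w ^ r)"
    using distributed_integrable[OF dens _ nonneg, of "\<lambda>x. x ^ r"] int
    by (simp add: ind set_integrable_def)
  have expect: "(LINT w|M. X w ^ r) = (LINT x:{0<..<1}|lborel. x ^ r * rtuomg_density \<alpha> \<beta> p x)"
    using distributed_integral[OF dens _ nonneg, of "\<lambda>x. x ^ r"]
    by (simp add: ind set_lebesgue_integral_def)
  have "(LINT w|M. X w ^ r) = 2 * \<alpha> * (1 - p) * I s + 2 * \<alpha>\<^sup>2 * p * L"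
    unfolding expect I_def L_def s_def by (rule rtuomg_moment_integral(2)[OF assms(2,3)])
  then have "complex_of_real (LINT w|M. X w ^ r) =
      of_real (2 * \<alpha> * (1 - p)) * of_real (I (s + 1 - 1)) + of_real (4 * p * \<alpha>\<^sup>2) * of_real (L / 2)"
    by (simp add: mult_ac)
  also have "complex_of_real (I (s + 1 - 1)) =
      of_real (Beta (s + 1) \<alpha>) * hyp2F1 (of_real (\<alpha> + 1)) (of_real (s + 1)) (of_real (s + 1 + \<alpha>)) (-1)"
    using s by (subst euler) auto
  also have "of_real (L / 2) = (\<Sum>n. T n)"
    using sums by (simp add: sums_iff)
  also have "s + 1 + \<alpha> = s + \<alpha> + 1"
    by simp
  finally show ?thesis
    using integ int expect sums_summable[OF sums] unfolding T_def s_def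
    by (simp only: of_real_mult mult.assoc simp_thms)
qed

end
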